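(* Let $n>1$ be an integer with prime factorization $n=p_1^{a_1}p_2^{a_2}\cdots p_k^{a_k}$, where the $p_i$ are distinct primes and each $a_i\ge 1$. Let $L_n$ be the divisibility lattice of $n$. Then $D(L_n)=1$ if $a_1,\dots,a_k$ are distinct, and $D(L_n)=2$ otherwise.
   Context: The divisibility lattice $L_n$ is the poset of positive divisors of $n$ ordered by divisibility. A coloring of a poset is distinguishing if the only color-preserving automorphism is the identity; $D(P)$ is the least number of colors in a distinguishing coloring of $P$. *)

theory Defs
  imports Main "HOL-Computational_Algebra.Primes"
begin

text \<open>A poset is given by a carrier \<open>A\<close> and a relation \<open>r\<close> with \<^term>\<open>partial_order_on A r\<close>.\<close>

definition poset_automorphism :: "'a set \<Rightarrow> 'a rel \<Rightarrow> ('a \<Rightarrow> 'a) \<Rightarrow> bool" where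
  "poset_automorphism A r f \<longleftrightarrow>
     bij_betw f A A \<and> (\<forall>x\<in>A. \<forall>y\<in>A. (x, y) \<in> r \<longleftrightarrow> (f x, f y) \<in> r)"

definition distinguishing_coloring :: "'a set \<Rightarrow> 'a rel \<Rightarrow> ('a \<Rightarrow> 'c) \<Rightarrow> bool" where
  "distinguishing_coloring A r c \<longleftrightarrow>
     (\<forall>f. poset_automorphism A r f \<and> (\<forall>x\<in>A. c (f x) = c x) \<longrightarrow> (\<forall>x\<in>A. f x = x))"

text \<open>Meaningful only if some finite number of colors suffices, which holds for every
  finite \<open>A\<close> (see \<open>distinguishing_coloring_exists\<close>).\<close>

definition distinguishing_number :: "'a set \<Rightarrow> 'a rel \<Rightarrow> nat" where
  "distinguishing_number A r =
     (LEAST k. \<exists>c :: 'a \<Rightarrow> nat. c ` A \<subseteq> {..<k} \<and> distinguishing_coloring A r c)"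

lemma distinguishing_coloring_exists:
  assumes "finite A"
  shows "\<exists>k. \<exists>c :: 'a \<Rightarrow> nat. c ` A \<subseteq> {..<k} \<and> distinguishing_coloring A r c"
proof -
  obtain c :: "'a \<Rightarrow> nat" where c: "bij_betw c A {..<card A}"
    using ex_bij_betw_finite_nat[OF assms] by (auto simp: atLeast0LessThan)
  have "distinguishing_coloring A r c"
    unfolding distinguishing_coloring_def poset_automorphism_def
    using c by (metis bij_betw_apply bij_betw_imp_inj_on inj_onD)
  with c show ?thesis
    by (auto simp: bij_betw_def)
qed

definition div_carrier :: "nat \<Rightarrow> nat set" where
  "div_carrier n = {d. 0 < d \<and> d dvd n}"

definition div_order :: "nat \<Rightarrow> nat rel" where
  "div_order n = {(x, y). x \<in> div_carrier n \<and> y \<in> div_carrier n \<and> x dvd y}"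

lemma partial_order_on_div_order: "partial_order_on (div_carrier n) (div_order n)"
  unfolding partial_order_on_def preorder_on_def div_order_def
  by (auto simp: refl_on_def intro!: transI antisymI intro: dvd_trans dvd_antisym)

end

theory Submission
  imports Defs
begin

text \<open>
  An automorphism of a finite poset preserves the sizes of principal ideals, so it fixes every
  element that is comparable to its image. In \<open>L\<^sub>n\<close> this shows that an automorphism fixing
  all prime divisors of \<open>n\<close> fixes all prime powers, hence everything. An automorphism maps
  a prime to a prime with the same exponent in \<open>n\<close>, so it is trivial if the exponents are distinct;
  if two exponents agree, exchanging the two primes is a nontrivial automorphism.
  Two colors always suffice: give the products of initial segments of the
  prime divisors one color and everything else the other. The former form a chain, so an automorphism
  preserving the coloring fixes each of them, and these products separate the primes.
\<close>

section \<open>Automorphisms of finite posets\<close>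

text \<open>\<open>f\<close> carries the principal ideal of \<open>x\<close> bijectively onto that
  of \<open>f x\<close>. Comparability makes one ideal contain the other; being finite of equal size
  they coincide, and antisymmetry finishes.\<close>

lemma poset_automorphism_comparable_fixed:
  assumes aut: "poset_automorphism A r f" and "finite A" and po: "partial_order_on A r"
    and x: "x \<in> A" and comparable: "(x, f x) \<in> r \<or> (f x, x) \<in> r"
  shows "f x = x"
proof -
  define down where "down y = {z \<in> A. (z, y) \<in> r}" for y
  have fx: "f x \<in> A" and inj: "inj_on f A" and surj: "f ` A = A"
    using aut x by (auto simp: poset_automorphism_def bij_betw_def)
  have "f ` down x = down (f x)"
  proof
    show "f ` down x \<subseteq> down (f x)"
      using aut x by (auto simp: down_def poset_automorphism_def bij_betw_def)
    show "down (f x) \<subseteq> f ` down x"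
    proof
      fix y assume y: "y \<in> down (f x)"
      then obtain z where z: "z \<in> A" "y = f z"
        using surj by (auto simp: down_def)
      with y x aut have "z \<in> down x"
        by (auto simp: down_def poset_automorphism_def)
      with z show "y \<in> f ` down x" by blast
    qed
  qed
  moreover have "card (f ` down x) = card (down x)"
    by (rule card_image) (rule inj_on_subset[OF inj], auto simp: down_def)
  ultimately have card: "card (down (f x)) = card (down x)" by simp
  have fin: "finite (down y)" for y
    using \<open>finite A\<close> by (simp add: down_def)
  have refl: "(y, y) \<in> r" if "y \<in> A" for y
    using po that by (auto simp: partial_order_on_def preorder_on_def refl_on_def)
  have tr: "trans r" and anti: "antisym r"
    using po by (auto simp: partial_order_on_def preorder_on_def)
  have mono: "down y \<subseteq> down z" if "(y, z) \<in> r" for y z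
    using that tr by (auto simp: down_def dest: transD)
  have "down x = down (f x)"
    using comparable card mono fin by (metis card_subset_eq)
  then have "(x, f x) \<in> r" "(f x, x) \<in> r"
    using refl[OF x] refl[OF fx] x fx by (auto simp: down_def)
  with anti show ?thesis by (auto dest: antisymD)
qed

section \<open>Prime powers among the divisors\<close>

text \<open>Characterizes the powers of \<open>q\<close> in the lattice by the primes below them, a
  description that automorphisms respect.\<close>

lemma prime_power_divisors:
  fixes q n :: nat
  assumes q: "prime q" and n: "n > 0"
  shows "{x \<in> div_carrier n. \<forall>r. prime r \<and> r dvd x \<longrightarrow> r = q} = (\<lambda>b. q ^ b) ` {..multiplicity q n}"
proof (intro equalityI subsetI)
  fix x assume "x \<in> {x \<in> div_carrier n. \<forall>r. prime r \<and> r dvd x \<longrightarrow> r = q}"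
  then have x: "x > 0" "x dvd n" and only: "\<And>r. prime r \<Longrightarrow> r dvd x \<Longrightarrow> r = q"
    by (auto simp: div_carrier_def)
  have "prime_factors x \<subseteq> {q}"
    using only by (auto simp: prime_factors_dvd)
  \<comment> \<open>The case without prime factors is \<open>x = 1\<close>, the power with exponent
    0.\<close>
  then have "x = q ^ multiplicity q x"
    using prime_factorization_nat[OF x(1)]
    by (cases "prime_factors x = {}")
       (auto simp: subset_singleton_iff not_dvd_imp_multiplicity_0 in_prime_factors_iff)
  moreover have "multiplicity q x \<le> multiplicity q n"
    using x n by (intro dvd_imp_multiplicity_le) auto
  ultimately show "x \<in> (\<lambda>b. q ^ b) ` {..multiplicity q n}" by blast
next
  fix x assume "x \<in> (\<lambda>b. q ^ b) ` {..multiplicity q n}"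
  then obtain b where b: "x = q ^ b" "b \<le> multiplicity q n" by auto
  have "r = q" if "prime r" "r dvd x" for r
    using that q b by (metis prime_dvd_power primes_dvd_imp_eq)
  moreover have "x dvd n" using b by (auto intro: multiplicity_dvd')
  ultimately show "x \<in> {x \<in> div_carrier n. \<forall>r. prime r \<and> r dvd x \<longrightarrow> r = q}"
    using b prime_gt_0_nat[OF q] by (auto simp: div_carrier_def)
qed

lemma card_prime_power_divisors:
  fixes q n :: nat
  assumes q: "prime q" and n: "n > 0"
  shows "card {x \<in> div_carrier n. \<forall>r. prime r \<and> r dvd x \<longrightarrow> r = q} = Suc (multiplicity q n)"
  unfolding prime_power_divisors[OF assms]
  using prime_gt_1_nat[OF q] by (subst card_image) (auto simp: inj_on_def)

section \<open>Automorphisms of the divisibility lattice\<close>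

locale div_automorphism =
  fixes n :: nat and f :: "nat \<Rightarrow> nat"
  assumes n_pos: "n > 0"
    and aut: "poset_automorphism (div_carrier n) (div_order n) f"
begin

lemma closed: "x \<in> div_carrier n \<Longrightarrow> f x \<in> div_carrier n"
  using aut by (auto simp: poset_automorphism_def bij_betw_def)

lemma dvd_iff: "x \<in> div_carrier n \<Longrightarrow> y \<in> div_carrier n \<Longrightarrow> f x dvd f y \<longleftrightarrow> x dvd y"
  using aut closed by (auto simp: poset_automorphism_def div_order_def)

lemma surjE:
  assumes "y \<in> div_carrier n"
  obtains x where "x \<in> div_carrier n" "y = f x"
  using assms aut by (metis poset_automorphism_def bij_betw_def imageE)

lemma inj: "inj_on f (div_carrier n)"
  using aut by (auto simp: poset_automorphism_def bij_betw_def)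

lemma comparable_fixed:
  assumes x: "x \<in> div_carrier n" and "x dvd f x \<or> f x dvd x"
  shows "f x = x"
proof (rule poset_automorphism_comparable_fixed[OF aut _ partial_order_on_div_order x])
  show "finite (div_carrier n)"
    using n_pos by (auto simp: div_carrier_def)
  show "(x, f x) \<in> div_order n \<or> (f x, x) \<in> div_order n"
    using assms closed[OF x] by (auto simp: div_order_def)
qed

lemma one_fixed: "f 1 = 1"
  using n_pos by (intro comparable_fixed) (auto simp: div_carrier_def)

text \<open>The prime divisors of \<open>n\<close> are the atoms of the lattice: a divisor of
  \<open>f q\<close> is the image of a divisor of \<open>q\<close>, hence \<open>f 1 = 1\<close> or
  \<open>f q\<close>.\<close>

lemma prime_image:
  assumes q: "prime q" "q dvd n"
  shows "prime (f q)"
proof -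
  have qc: "q \<in> div_carrier n" and oc: "1 \<in> div_carrier n"
    using q n_pos by (auto simp: div_carrier_def prime_gt_0_nat)
  have "f q \<noteq> 1"
    using inj_onD[OF inj _ qc oc] one_fixed q by auto
  moreover have "m = 1 \<or> m = f q" if m: "m dvd f q" for m
  proof -
    have "m \<in> div_carrier n"
      using m closed[OF qc] by (auto simp: div_carrier_def intro: dvd_trans dvd_pos_nat)
    then obtain x where x: "x \<in> div_carrier n" "m = f x" by (rule surjE)
    then have "x dvd q" using m dvd_iff qc by simp
    then have "x = 1 \<or> x = q" using q by (simp add: prime_nat_iff)
    then show ?thesis using x one_fixed by auto
  qed
  moreover have "f q > 0" using closed[OF qc] by (simp add: div_carrier_def)
  ultimately show ?thesis by (auto simp: prime_nat_iff)
qed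

text \<open>By surjectivity \<open>r = f s\<close> with \<open>s\<close> dividing \<open>x\<close>.
  A prime \<open>t\<close> dividing \<open>s\<close> has a prime image dividing \<open>r\<close>, so
  \<open>f t = f s\<close>, and injectivity shows that \<open>s = t\<close> is itself prime.\<close>

lemma prime_divisor_image:
  assumes x: "x \<in> div_carrier n" and r: "prime r" "r dvd f x"
  obtains s where "prime s" "s dvd x" "r = f s"
proof -
  have "r \<in> div_carrier n"
    using r closed[OF x] by (auto simp: div_carrier_def prime_gt_0_nat intro: dvd_trans)
  then obtain s where s: "s \<in> div_carrier n" "r = f s" by (rule surjE)
  have sx: "s dvd x" using s r x dvd_iff by simp
  have "s \<noteq> 1" using s r one_fixed by auto
  then obtain t where t: "prime t" "t dvd s" using prime_factor_nat by blast
  then have tc: "t \<in> div_carrier n"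
    using s by (auto simp: div_carrier_def prime_gt_0_nat intro: dvd_trans)
  then have "f t dvd r" using t s dvd_iff by simp
  moreover have "prime (f t)" using prime_image t tc by (auto simp: div_carrier_def)
  ultimately have "f t = f s" using r s by (simp add: primes_dvd_imp_eq)
  then have "t = s" using inj_onD[OF inj] tc s by blast
  with t sx s that show ?thesis by blast
qed

text \<open>\<open>f\<close> matches the primes below an element with those below its image. So it
  maps the powers of \<open>q\<close> in the lattice onto those of \<open>f q\<close>, and counting
  them recovers the exponents.\<close>

lemma multiplicity_image:
  assumes q: "prime q" "q dvd n"
  shows "multiplicity (f q) n = multiplicity q n"
proof -
  define S where "S q = {x \<in> div_carrier n. \<forall>r. prime r \<and> r dvd x \<longrightarrow> r = q}" for q
  have qc: "q \<in> div_carrier n"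
    using q by (auto simp: div_carrier_def prime_gt_0_nat)
  have "f ` S q = S (f q)"
  proof (intro equalityI subsetI)
    fix y assume "y \<in> f ` S q"
    then show "y \<in> S (f q)"
      by (auto simp: S_def closed elim: prime_divisor_image)
  next
    fix y assume y: "y \<in> S (f q)"
    then obtain x where x: "x \<in> div_carrier n" "y = f x"
      using surjE by (auto simp: S_def)
    have "r = q" if r: "prime r" "r dvd x" for r
    proof -
      have rc: "r \<in> div_carrier n"
        using r x by (auto simp: div_carrier_def prime_gt_0_nat intro: dvd_trans)
      then have "f r dvd y" "prime (f r)"
        using r x dvd_iff prime_image by (auto simp: div_carrier_def)
      then have "f r = f q" using y by (auto simp: S_def)
      then show ?thesis using inj_onD[OF inj] rc qc by blast
    qed
    with x show "y \<in> f ` S q" by (auto simp: S_def)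
  qed
  moreover have "card (f ` S q) = card (S q)"
    by (rule card_image) (rule inj_on_subset[OF inj], auto simp: S_def)
  ultimately show ?thesis
    using card_prime_power_divisors[OF q(1) n_pos] card_prime_power_divisors[OF prime_image[OF q] n_pos]
    by (simp add: S_def)
qed

lemma identity_if_primes_fixed:
  assumes fixed: "\<And>q. prime q \<Longrightarrow> q dvd n \<Longrightarrow> f q = q" and x: "x \<in> div_carrier n"
  shows "f x = x"
proof -
  have prime_power: "f (q ^ b) = q ^ b" if q: "prime q" and b: "q ^ b dvd n" for q b
  proof -
    have c: "q ^ b \<in> div_carrier n"
      using q b by (auto simp: div_carrier_def prime_gt_0_nat)
    have "r = q" if r: "prime r" "r dvd f (q ^ b)" for r
    proof -
      obtain s where s: "prime s" "s dvd q ^ b" "r = f s"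
        using prime_divisor_image[OF c r] by blast
      then have "s = q" using q by (metis prime_dvd_power primes_dvd_imp_eq)
      moreover have "s dvd n" using s b by (blast intro: dvd_trans)
      ultimately show ?thesis using s fixed by simp
    qed
    \<comment> \<open>The exponent \<open>e\<close> may a priori differ from \<open>b\<close>, but
      two powers of \<open>q\<close> are always comparable.\<close>
    then obtain e where "f (q ^ b) = q ^ e"
      using prime_power_divisors[OF q n_pos] closed[OF c] by blast
    then show ?thesis
      using le_imp_power_dvd[of b e q] le_imp_power_dvd[of e b q]
      by (intro comparable_fixed[OF c]) (metis nat_le_linear)
  qed
  \<comment> \<open>This one divisibility suffices, by \<open>comparable_fixed\<close>. It holds
    because each prime power dividing \<open>x\<close> is fixed and so divides
    \<open>f x\<close>.\<close>
  have "x dvd f x"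
  proof (rule multiplicity_le_imp_dvd)
    show "x \<noteq> 0" using x by (simp add: div_carrier_def)
    fix q :: nat assume q: "prime q"
    define b where "b = multiplicity q x"
    have b: "q ^ b dvd x" by (simp add: b_def multiplicity_dvd)
    then have bn: "q ^ b dvd n" using x by (auto simp: div_carrier_def intro: dvd_trans)
    then have "q ^ b \<in> div_carrier n"
      using q by (auto simp: div_carrier_def prime_gt_0_nat)
    then have "q ^ b dvd f x"
      using dvd_iff[OF _ x] b prime_power[OF q bn] by metis
    moreover have "f x \<noteq> 0" "\<not> is_unit q"
      using closed[OF x] q by (auto simp: div_carrier_def)
    ultimately show "multiplicity q x \<le> multiplicity q (f x)"
      unfolding b_def by (intro multiplicity_geI) auto
  qed
  then show ?thesis using comparable_fixed x by blast
qed

end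

section \<open>Distinguishing colorings with one and two colors\<close>

lemma distinguishing_coloring_div_order_inj:
  assumes n: "n > 0" and inj_mult: "inj_on (\<lambda>q. multiplicity q n) (prime_factors n)"
  shows "distinguishing_coloring (div_carrier n) (div_order n) c"
  unfolding distinguishing_coloring_def
proof (intro allI impI ballI)
  fix f x
  assume f: "poset_automorphism (div_carrier n) (div_order n) f \<and> (\<forall>x\<in>div_carrier n. c (f x) = c x)"
    and x: "x \<in> div_carrier n"
  interpret div_automorphism n f using n f by unfold_locales auto
  have "f q = q" if q: "prime q" "q dvd n" for q
  proof (rule inj_onD[OF inj_mult])
    show "multiplicity (f q) n = multiplicity q n" using multiplicity_image q by simp
    have "q \<in> div_carrier n" using q by (auto simp: div_carrier_def prime_gt_0_nat)
    then show "f q \<in> prime_factors n" "q \<in> prime_factors n"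
      using q n prime_image closed by (auto simp: in_prime_factors_iff div_carrier_def)
  qed
  then show "f x = x" using identity_if_primes_fixed x by blast
qed

text \<open>The chain is indexed by all natural numbers \<open>m\<close> as thresholds, with
  repetitions, which spares an enumeration of the primes.\<close>

lemma distinguishing_coloring_div_order_chain:
  fixes n :: nat
  assumes n: "n > 0"
  defines "d \<equiv> \<lambda>m. \<Prod>{r \<in> prime_factors n. r \<le> m}"
  shows "distinguishing_coloring (div_carrier n) (div_order n) (\<lambda>x. if x \<in> range d then 1 else 0 :: nat)"
  unfolding distinguishing_coloring_def
proof (intro allI impI ballI)
  fix f x
  assume f: "poset_automorphism (div_carrier n) (div_order n) f \<and>
      (\<forall>x\<in>div_carrier n. (if f x \<in> range d then 1 else 0 :: nat) = (if x \<in> range d then 1 else 0))"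
    and x: "x \<in> div_carrier n"
  interpret div_automorphism n f using n f by unfold_locales auto
  have dc: "d m \<in> div_carrier n" for m
  proof -
    \<comment> \<open>\<open>d m\<close> divides the radical of \<open>n\<close>, which divides
      \<open>n\<close>.\<close>
    have "d m dvd \<Prod>(prime_factors n)"
      unfolding d_def by (rule prod_dvd_prod_subset) auto
    also have "\<dots> dvd (\<Prod>q\<in>prime_factors n. q ^ multiplicity q n)"
      by (rule prod_dvd_prod) (auto simp: prime_factors_multiplicity)
    also have "\<dots> = n" using prime_factorization_nat[OF n] by simp
    finally have "d m dvd n" .
    then show ?thesis using n by (auto simp: div_carrier_def intro: dvd_pos_nat)
  qed
  have chain: "d i dvd d j" if "i \<le> j" for i j
    unfolding d_def using that by (intro prod_dvd_prod_subset) auto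
  have d_fixed: "f (d m) = d m" for m
  proof -
    have "(if f (d m) \<in> range d then 1 else 0 :: nat) = 1"
      using f dc[of m] by auto
    then obtain i where "f (d m) = d i" by (auto split: if_splits)
    then show ?thesis
      using chain[of i m] chain[of m i] by (intro comparable_fixed[OF dc]) (metis nat_le_linear)
  qed
  have prime_dvd_d: "q dvd d m \<longleftrightarrow> q \<le> m" if q: "prime q" "q dvd n" for q m
  proof
    assume "q dvd d m"
    then obtain r where "r \<in> prime_factors n" "r \<le> m" "q dvd r"
      unfolding d_def using q by (auto simp: prime_dvd_prod_iff)
    then show "q \<le> m" using q by (metis in_prime_factors_iff primes_dvd_imp_eq)
  next
    assume "q \<le> m"
    then show "q dvd d m"
      unfolding d_def using q n by (intro dvd_prodI[where f = "\<lambda>x. x"]) (auto simp: in_prime_factors_iff)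
  qed
  have "f q = q" if q: "prime q" "q dvd n" for q
  proof -
    have qc: "q \<in> div_carrier n" using q by (auto simp: div_carrier_def prime_gt_0_nat)
    then have fq: "prime (f q)" "f q dvd n"
      using q prime_image closed by (auto simp: div_carrier_def)
    \<comment> \<open>As \<open>d m\<close> is fixed, \<open>q\<close> divides it iff
      \<open>f q\<close> does. Taking \<open>m\<close> to be \<open>q\<close> and then
      \<open>f q\<close> yields equality.\<close>
    have "q \<le> m \<longleftrightarrow> f q \<le> m" for m
      using dvd_iff[OF qc dc] d_fixed prime_dvd_d[OF q] prime_dvd_d[OF fq] by simp
    then show ?thesis by (meson order_antisym order_refl)
  qed
  then show "f x = x" using identity_if_primes_fixed x by blast
qed

section \<open>Exchanging two primes with equal exponents\<close>

lemma prime_swap_automorphism: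
  fixes n :: nat
  assumes n: "n > 0" and p: "p \<in> prime_factors n" and q: "q \<in> prime_factors n"
    and mult: "multiplicity p n = multiplicity q n"
  shows "\<exists>f. poset_automorphism (div_carrier n) (div_order n) f \<and> f p = q"
proof -
  define s where "s r = (if r = p then q else if r = q then p else r)" for r
  \<comment> \<open>\<open>f\<close> permutes exponents along the transposition \<open>s\<close>:
    the exponent of \<open>r\<close> in \<open>f x\<close> is that of \<open>s r\<close> in
    \<open>x\<close>.\<close>
  define f where "f x = (\<Prod>r\<in>prime_factors n. r ^ multiplicity (s r) x)" for x :: nat
  have s_s: "s (s r) = r" for r by (simp add: s_def)
  have s_in: "s r \<in> prime_factors n \<longleftrightarrow> r \<in> prime_factors n" for r
    using p q by (auto simp: s_def)
  have s_mult: "multiplicity (s r) n = multiplicity r n" for r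
    using mult by (simp add: s_def)
  have f_pos: "f x > 0" for x
    by (auto simp: f_def intro!: prod_pos prime_gt_0_nat)
  have f_mult: "multiplicity r (f x) = (if r \<in> prime_factors n then multiplicity (s r) x else 0)"
    if "prime r" for r x
    unfolding f_def using that by (intro multiplicity_prod_prime_powers) auto
  have zero: "multiplicity r x = 0" if "x \<in> div_carrier n" "prime r" "r \<notin> prime_factors n" for r x
    using that n by (auto simp: div_carrier_def in_prime_factors_iff
        intro!: not_dvd_imp_multiplicity_0 intro: dvd_trans)
  have dvd_mult: "x dvd y \<longleftrightarrow> (\<forall>r. prime r \<longrightarrow> multiplicity r x \<le> multiplicity r y)"
    if "x > 0" "y > 0" for x y :: nat
    using that by (auto intro: multiplicity_le_imp_dvd dvd_imp_multiplicity_le)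
  have f_dvd_iff: "f x dvd f y \<longleftrightarrow> x dvd y" if x: "x \<in> div_carrier n" and y: "y \<in> div_carrier n" for x y
  proof -
    have "f x dvd f y \<longleftrightarrow> (\<forall>r\<in>prime_factors n. multiplicity (s r) x \<le> multiplicity (s r) y)"
      by (auto simp: dvd_mult f_pos f_mult)
    \<comment> \<open>Reindexing along the involution \<open>s\<close>, which permutes the prime
      factors of \<open>n\<close>.\<close>
    also have "\<dots> \<longleftrightarrow> (\<forall>r\<in>prime_factors n. multiplicity r x \<le> multiplicity r y)"
      by (metis s_s s_in)
    also have "\<dots> \<longleftrightarrow> x dvd y"
    proof -
      have "x > 0" "y > 0" using x y by (auto simp: div_carrier_def)
      then show ?thesis
        using zero[OF x] by (auto simp: dvd_mult)
    qed
    finally show ?thesis .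
  qed
  have closed: "f x \<in> div_carrier n" if x: "x \<in> div_carrier n" for x
  proof -
    \<comment> \<open>Here the equality of the two exponents keeps \<open>f x\<close> a divisor of
      \<open>n\<close>.\<close>
    have "multiplicity (s r) x \<le> multiplicity r n" for r
      using x n dvd_imp_multiplicity_le[of x n "s r"] by (simp add: div_carrier_def s_mult)
    then have "f x dvd n" using n by (auto simp: dvd_mult f_pos f_mult)
    then show ?thesis by (simp add: div_carrier_def f_pos)
  qed
  have invol: "f (f x) = x" if x: "x \<in> div_carrier n" for x
  proof (rule multiplicity_eq_nat)
    show "f (f x) > 0" "x > 0" using x f_pos by (auto simp: div_carrier_def)
    fix r :: nat assume r: "prime r"
    show "multiplicity r (f (f x)) = multiplicity r x"
    proof (cases "r \<in> prime_factors n")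
      case True
      then have "s r \<in> prime_factors n" "prime (s r)" using s_in by blast+
      then show ?thesis using r True by (auto simp: f_mult s_s)
    next
      case False
      then show ?thesis using r zero[OF x] by (simp add: f_mult)
    qed
  qed
  have pq: "prime p" "prime q" "p dvd n" using p q by (auto simp: in_prime_factors_iff)
  have "poset_automorphism (div_carrier n) (div_order n) f"
    unfolding poset_automorphism_def
    using closed invol f_dvd_iff
    by (auto simp: div_order_def intro!: bij_betw_byWitness[where f' = f])
  moreover have "f p = q"
  proof (rule multiplicity_eq_nat)
    show "f p > 0" "q > 0" using f_pos pq prime_gt_0_nat by auto
    fix r :: nat assume r: "prime r"
    have "prime (s r)" using r pq by (simp add: s_def)
    then show "multiplicity r (f p) = multiplicity r q"
      using r pq q by (auto simp: f_mult prime_multiplicity_other s_def split: if_splits)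
  qed
  ultimately show ?thesis by blast
qed

section \<open>The distinguishing number\<close>

text \<open>Stated without an indexed factorization. It covers \<open>n = 1\<close>, where there are
  no prime factors and injectivity is vacuous.\<close>

theorem distinguishing_number_div_order:
  assumes n: "n > 0"
  shows "distinguishing_number (div_carrier n) (div_order n) =
    (if inj_on (\<lambda>q. multiplicity q n) (prime_factors n) then 1 else 2)"
proof -
  have one: "1 \<in> div_carrier n" by (simp add: div_carrier_def)
  show ?thesis
  proof (cases "inj_on (\<lambda>q. multiplicity q n) (prime_factors n)")
    case True
    have "distinguishing_number (div_carrier n) (div_order n) = 1"
      unfolding distinguishing_number_def
    proof (rule Least_equality)
      show "\<exists>c :: nat \<Rightarrow> nat. c ` div_carrier n \<subseteq> {..<1} \<and>
          distinguishing_coloring (div_carrier n) (div_order n) c"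
        using distinguishing_coloring_div_order_inj[OF n True]
        by (intro exI[of _ "\<lambda>_. 0"]) auto
    \<comment> \<open>Zero colors are impossible because the divisor 1 has to receive a
      color.\<close>
    qed (use one in \<open>auto simp: Suc_le_eq\<close>)
    with True show ?thesis by simp
  next
    case False
    then obtain p q where pq: "p \<in> prime_factors n" "q \<in> prime_factors n" "p \<noteq> q"
      "multiplicity p n = multiplicity q n" by (auto simp: inj_on_def)
    obtain f where f: "poset_automorphism (div_carrier n) (div_order n) f" "f p = q"
      using prime_swap_automorphism[OF n pq(1,2,4)] by blast
    have "distinguishing_number (div_carrier n) (div_order n) = 2"
      unfolding distinguishing_number_def
    proof (rule Least_equality)
      show "\<exists>c :: nat \<Rightarrow> nat. c ` div_carrier n \<subseteq> {..<2} \<and>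
          distinguishing_coloring (div_carrier n) (div_order n) c"
        using distinguishing_coloring_div_order_chain[OF n] by (intro exI conjI) auto
    next
      fix k
      assume "\<exists>c :: nat \<Rightarrow> nat. c ` div_carrier n \<subseteq> {..<k} \<and>
          distinguishing_coloring (div_carrier n) (div_order n) c"
      then obtain c :: "nat \<Rightarrow> nat" where c: "c ` div_carrier n \<subseteq> {..<k}"
        "distinguishing_coloring (div_carrier n) (div_order n) c" by blast
      show "2 \<le> k"
      proof (rule ccontr)
        assume "\<not> 2 \<le> k"
        \<comment> \<open>With at most one color the coloring is constant, so the exchange
          \<open>f\<close> of \<open>p\<close> and \<open>q\<close> preserves it.\<close>
        then have const: "c x = 0" if "x \<in> div_carrier n" for x
          using c(1) that by fastforce
        have "f x \<in> div_carrier n" if "x \<in> div_carrier n" for x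
          using f that by (auto simp: poset_automorphism_def bij_betw_def)
        then have "\<forall>x\<in>div_carrier n. f x = x"
          using c(2) f const unfolding distinguishing_coloring_def by metis
        moreover have "p \<in> div_carrier n"
          using pq by (auto simp: div_carrier_def in_prime_factors_iff prime_gt_0_nat)
        ultimately show False using f pq by auto
      qed
    qed
    with False show ?thesis by simp
  qed
qed

theorem theorem3p12:
  fixes n k :: nat and p a :: "nat \<Rightarrow> nat"
  assumes "n > 1"
    and "\<And>i. i \<in> {1..k} \<Longrightarrow> prime (p i)"
    and "inj_on p {1..k}"
    and "\<And>i. i \<in> {1..k} \<Longrightarrow> a i \<ge> 1"
    and "n = (\<Prod>i=1..k. p i ^ a i)"
  shows "(inj_on a {1..k} \<longrightarrow> distinguishing_number (div_carrier n) (div_order n) = 1) \<and>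
         (\<not> inj_on a {1..k} \<longrightarrow> distinguishing_number (div_carrier n) (div_order n) = 2)"
proof -
  define P where "P = p ` {1..k}"
  \<comment> \<open>Transfers the exponents from indices to primes, so that injectivity of
    \<open>a\<close> can be compared with injectivity of \<open>multiplicity\<close> on
    \<open>prime_factors n\<close>.\<close>
  define e where "e q = a (the_inv_into {1..k} p q)" for q
  have e_p: "e (p i) = a i" if "i \<in> {1..k}" for i
    using that assms(3) by (simp add: e_def the_inv_into_f_f)
  have prime_P: "prime q" if "q \<in> P" for q
    using that assms(2) by (auto simp: P_def)
  have n_eq: "n = (\<Prod>q\<in>P. q ^ e q)"
    unfolding P_def assms(5) prod.reindex[OF assms(3)] by (intro prod.cong) (auto simp: e_p)
  have mult: "multiplicity q n = (if q \<in> P then e q else 0)" if "prime q" for q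
    unfolding n_eq using that prime_P by (intro multiplicity_prod_prime_powers) (auto simp: P_def)
  have e_pos: "e q > 0" if "q \<in> P" for q
    using that assms(4) e_p by (fastforce simp: P_def)
  \<comment> \<open>Positive exponents ensure that every prime in \<open>P\<close> really divides
    \<open>n\<close>.\<close>
  have "prime_factors n = P"
    using mult e_pos prime_P by (auto simp: prime_factors_multiplicity split: if_splits)
  moreover have "inj_on (\<lambda>q. multiplicity q n) P \<longleftrightarrow> inj_on e P"
    using mult prime_P by (intro inj_on_cong) auto
  moreover have "inj_on e P \<longleftrightarrow> inj_on (e \<circ> p) {1..k}"
    unfolding P_def using assms(3) by (meson comp_inj_on inj_on_imageI)
  moreover have "inj_on (e \<circ> p) {1..k} \<longleftrightarrow> inj_on a {1..k}"
    using e_p by (intro inj_on_cong) auto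
  ultimately show ?thesis
    using distinguishing_number_div_order[of n] assms(1) by simp
qed

end
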